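(* Let $k_1\in\mathbb{Z}$, let $n\ge0$ be an integer, let $x,y\in\mathbb{R}$, and let $b>0$ with $b\ne1$. Then $$B_n^{(k_1)}(x+y;1,b,b)=\frac12\sum_{k=0}^{n}\binom{n}{k}\left[B_k^{(k_1)}(y;1,b,b)+B_k^{(k_1)}(y+1;1,b,b)\right]E_{n-k}(x;1,b,b).$$
   Context: For $k\in\mathbb{Z}$ and $|z|<1$ let $\mathrm{Li}_k(z)=\sum_{m\ge1} z^m/m^k$. For positive reals $a,b$ with $ab\ne1$ and $c>0$, the generalized poly-Bernoulli polynomials $B_n^{(k)}(x;a,b,c)$ are defined by the power series expansion in $t$ near $0$: $\frac{\mathrm{Li}_k(1-(ab)^{-t})}{b^t-a^{-t}}c^{xt}=\sum_{n\ge0}B_n^{(k)}(x;a,b,c)\frac{t^n}{n!}$. The generalized Euler polynomials $E_n(x;a,b,c)$ are defined by $\frac{2c^{xt}}{b^t+a^t}=\sum_{n\ge0}E_n(x;a,b,c)\frac{t^n}{n!}$; in particular $\frac{2b^{xt}}{b^t+1}=\sum_{n\ge0}E_n(x;1,b,b)\frac{t^n}{n!}$. *)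

theory Defs
  imports Complex_Main
begin

definition polylog :: "int \<Rightarrow> real \<Rightarrow> real" where
  "polylog k z = (\<Sum>m. z ^ Suc m / of_nat (Suc m) powi k)"

text \<open>
  The coefficient sequence of the expansion \<open>f t = (\<Sum>n. B n * t ^ n / n!)\<close> near \<open>0\<close>. The equation
  is required only on a punctured neighbourhood, because \<open>f\<close> may be given by an expression with a
  removable singularity at \<open>0\<close> (such as \<open>0 / 0\<close>, which HOL evaluates to \<open>0\<close>). The sequence is unique
  whenever it exists.
\<close>
definition egf_coeffs :: "(real \<Rightarrow> real) \<Rightarrow> nat \<Rightarrow> real" where
  "egf_coeffs f = (THE B. \<forall>\<^sub>F t in at 0. (\<lambda>n. B n * (t ^ n / fact n)) sums f t)"

definition gen_poly_bernoulli ::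
    "int \<Rightarrow> nat \<Rightarrow> real \<Rightarrow> real \<Rightarrow> real \<Rightarrow> real \<Rightarrow> real" where
  "gen_poly_bernoulli k n x a b c =
     egf_coeffs (\<lambda>t. polylog k (1 - (a * b) powr (- t)) / (b powr t - a powr (- t))
                       * c powr (x * t)) n"

definition gen_euler :: "nat \<Rightarrow> real \<Rightarrow> real \<Rightarrow> real \<Rightarrow> real \<Rightarrow> real" where
  "gen_euler n x a b c = egf_coeffs (\<lambda>t. 2 * c powr (x * t) / (b powr t + a powr t)) n"

end

theory Submission
  imports Defs "HOL-Complex_Analysis.Complex_Analysis"
begin

text \<open>
  Writing \<open>L = ln b\<close>, the generating function of the polynomials \<open>B\<^sub>n(x; 1, b, b)\<close> is
  \<open>\<Phi>(t) exp (x L t)\<close>, where \<open>\<Phi>\<close> is analytic at \<open>0\<close>: since \<open>b\<^sup>t - 1 = b\<^sup>t (1 - b\<^sup>-\<^sup>t)\<close>, the zero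
  of the denominator cancels against the factor \<open>z\<close> of \<open>Li\<^sub>k(z)\<close> at \<open>z = 1 - b\<^sup>-\<^sup>t\<close>. Hence all the
  coefficient sequences exist, and the claim is the coefficient form of
  \<open>(\<Phi> exp (y L t) + \<Phi> exp ((y + 1) L t)) \<cdot> 2 exp (x L t) / (exp (L t) + 1) = 2 \<Phi> exp ((x + y) L t)\<close>.
\<close>

text \<open>Identity principle: zeros of a nonzero power series are isolated. The hypothesis avoids
  \<open>t = 0\<close> because \<open>egf_coeffs\<close> fixes the expansion only on a punctured
  neighbourhood.\<close>

lemma powser_sums_zero_imp_zero:
  fixes a :: "nat \<Rightarrow> 'a :: {real_normed_field, banach}"
  assumes "\<forall>\<^sub>F t in at 0. (\<lambda>n. a n * t ^ n) sums 0"
  shows "a m = 0"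
proof -
  obtain r where r: "r > 0" "\<And>t. t \<noteq> 0 \<Longrightarrow> norm t < r \<Longrightarrow> (\<lambda>n. a n * t ^ n) sums 0"
    using assms by (auto simp: eventually_at dist_norm)
  obtain z :: 'a where z: "z \<noteq> 0" "norm z < r"
    using \<open>r > 0\<close> by (intro that[of "of_real (r / 2)"]) auto
  have "summable (\<lambda>n. a n * z ^ n)"
    using r(2)[OF z] by (rule sums_summable)
  hence "conv_radius a \<ge> norm z"
    by (rule conv_radius_geI)
  hence "fps_conv_radius (Abs_fps a) > 0"
    using z(1) by (auto simp: fps_conv_radius_def zero_ereal_def
        intro: less_le_trans[of _ "ereal (norm z)"])
  \<comment> \<open>Nothing is assumed at \<open>0\<close> itself, so the constant coefficient is
    recovered as a limit; once it vanishes, the sum is \<open>0\<close> on the whole disc.\<close>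
  hence "isCont (eval_fps (Abs_fps a)) 0"
    by (intro continuous_eval_fps) (auto simp: zero_ereal_def)
  hence "(eval_fps (Abs_fps a) \<longlongrightarrow> a 0) (at 0)"
    by (simp add: isCont_def eval_fps_at_0)
  moreover have "\<forall>\<^sub>F t in at 0. eval_fps (Abs_fps a) t = 0"
    using assms by eventually_elim (simp add: eval_fps_def sums_iff)
  hence "(eval_fps (Abs_fps a) \<longlongrightarrow> 0) (at 0)"
    by (rule tendsto_eventually)
  ultimately have a0: "a 0 = 0"
    by (intro tendsto_unique[of "at (0::'a)"]) auto
  have sums: "(\<lambda>n. a n * (t - 0) ^ n) sums 0" if "norm (t - 0) < r" for t
    using r(2)[of t] that a0 powser_sums_zero[of a] by (cases "t = 0") auto
  show ?thesis
  proof (rule ccontr)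
    assume "a m \<noteq> 0"
    with a0 have "m > 0"
      by (cases m) auto
    \<comment> \<open>For the zero function, isolation of the zero at \<open>0\<close> reads
      \<open>0 \<noteq> 0\<close> on a punctured disc.\<close>
    obtain s where s: "s > 0" "\<And>z::'a. z \<in> cball 0 s - {0} \<Longrightarrow> (0::'a) \<noteq> 0"
      using powser_0_nonzero[OF r(1) sums refl \<open>a m \<noteq> 0\<close> \<open>m > 0\<close>] by blast
    from s(2)[of "of_real s"] s(1) show False
      by simp
  qed
qed

lemma has_fps_expansion_imp_eventually_sums:
  fixes F :: "'a :: {banach, real_normed_div_algebra} fps"
  assumes "f has_fps_expansion F"
  shows "\<forall>\<^sub>F z in nhds 0. (\<lambda>n. fps_nth F n * z ^ n) sums f z"
proof -
  have "\<forall>\<^sub>F z in nhds 0. z \<in> eball 0 (fps_conv_radius F)"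
    using assms by (intro eventually_nhds_in_open) (auto simp: has_fps_expansion_def zero_ereal_def)
  moreover have "\<forall>\<^sub>F z in nhds 0. eval_fps F z = f z"
    using assms by (simp add: has_fps_expansion_def)
  ultimately show ?thesis
  proof eventually_elim
    case (elim z)
    thus ?case using sums_eval_fps[of z F] by simp
  qed
qed

text \<open>Evaluates the definite description: \<open>F\<close> gives existence and the identity
  principle gives uniqueness. Here \<open>g\<close> is the continuation of \<open>f\<close> across a
  removable singularity.\<close>

lemma egf_coeffs_eqI:
  assumes F: "g has_fps_expansion F" and fg: "\<forall>\<^sub>F t in at 0. f t = g t"
  shows "egf_coeffs f n = fact n * fps_nth F n"
proof -
  have "\<forall>\<^sub>F t in at 0. (\<lambda>n. fps_nth F n * t ^ n) sums g t"
    using has_fps_expansion_imp_eventually_sums[OF F]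
    by (auto simp: eventually_at_filter elim: eventually_mono)
  with fg have sums: "\<forall>\<^sub>F t in at 0. (\<lambda>n. fps_nth F n * t ^ n) sums f t"
    by eventually_elim simp
  have "egf_coeffs f = (\<lambda>n. fact n * fps_nth F n)"
    unfolding egf_coeffs_def
  proof (rule the_equality)
    show "\<forall>\<^sub>F t in at 0. (\<lambda>n. fact n * fps_nth F n * (t ^ n / fact n)) sums f t"
      using sums by (simp add: field_simps)
  next
    fix B assume "\<forall>\<^sub>F t in at 0. (\<lambda>n. B n * (t ^ n / fact n)) sums f t"
    with sums have "\<forall>\<^sub>F t in at 0. (\<lambda>n. (B n / fact n - fps_nth F n) * t ^ n) sums 0"
    proof eventually_elim
      case (elim t)
      show ?case
        using sums_diff[OF elim(2,1)] by (simp add: algebra_simps)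
    qed
    hence "B n / fact n - fps_nth F n = 0" for n
      by (rule powser_sums_zero_imp_zero)
    thus "B = (\<lambda>n. fact n * fps_nth F n)"
      by (intro ext) (simp add: field_simps)
  qed
  thus ?thesis by simp
qed

text \<open>Brings an expansion obtained over the complex numbers back to the real line; real parts
  pass through termwise because powers of a real \<open>t\<close> are real.\<close>

lemma has_fps_expansion_Re:
  fixes h :: "complex \<Rightarrow> complex"
  assumes "h has_fps_expansion H"
  shows "(\<lambda>t. Re (h (of_real t))) has_fps_expansion Abs_fps (\<lambda>n. Re (fps_nth H n))"
proof (rule has_fps_expansionI)
  have "\<forall>\<^sub>F z in nhds 0. (\<lambda>n. fps_nth H n * z ^ n) sums h z"
    using assms by (rule has_fps_expansion_imp_eventually_sums)
  moreover have "filterlim complex_of_real (nhds 0) (nhds 0)"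
    using tendsto_of_real[OF filterlim_ident, of "0::real"] by simp
  ultimately have "\<forall>\<^sub>F t in nhds 0. (\<lambda>n. fps_nth H n * of_real t ^ n) sums h (of_real t)"
    by (rule eventually_compose_filterlim)
  thus "\<forall>\<^sub>F t in nhds 0. (\<lambda>n. fps_nth (Abs_fps (\<lambda>n. Re (fps_nth H n))) n * t ^ n) sums
          Re (h (of_real t))"
  proof eventually_elim
    case (elim t)
    from sums_Re[OF this] show ?case
      by (simp flip: of_real_power)
  qed
qed

text \<open>The index shift makes this the series of \<open>Li\<^sub>k(z) / z\<close>.\<close>

definition polylog_fps :: "int \<Rightarrow> complex fps" where
  "polylog_fps k = Abs_fps (\<lambda>n. 1 / of_nat (Suc n) powi k)"

text \<open>Ratio test: consecutive coefficients have ratio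
  \<open>((n + 2) / (n + 1)) powi k\<close>, which tends to \<open>1\<close> for \<open>k\<close> of
  either sign.\<close>

lemma fps_conv_radius_polylog_fps: "fps_conv_radius (polylog_fps k) = 1"
proof -
  have "(\<lambda>n. (real (Suc (Suc n)) / real (Suc n)) powi k) \<longlonglongrightarrow> 1 powi k"
  proof (rule tendsto_power_int)
    show "(\<lambda>n. real (Suc (Suc n)) / real (Suc n)) \<longlonglongrightarrow> 1"
      using LIMSEQ_Suc_n_over_n[THEN LIMSEQ_Suc] by simp
  qed auto
  moreover have "(real (Suc (Suc n)) / real (Suc n)) powi k =
      norm (fps_nth (polylog_fps k) n) / norm (fps_nth (polylog_fps k) (Suc n))" for n
    unfolding polylog_fps_def fps_nth_Abs_fps
    by (simp only: norm_divide norm_power_int norm_of_nat norm_one power_int_divide_distrib)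
       (simp add: field_simps)
  ultimately have "(\<lambda>n. norm (fps_nth (polylog_fps k) n) / norm (fps_nth (polylog_fps k) (Suc n)))
      \<longlonglongrightarrow> 1"
    by simp
  hence "conv_radius (fps_nth (polylog_fps k)) = ereal 1"
    by (intro conv_radius_ratio_limit_nonzero)
       (simp_all add: polylog_fps_def power_int_eq_0_iff del: of_nat_Suc)
  thus ?thesis
    by (simp add: fps_conv_radius_def one_ereal_def)
qed

lemma polylog_eq_eval_fps:
  assumes "\<bar>z\<bar> < 1"
  shows "polylog k z = z * Re (eval_fps (polylog_fps k) (of_real z))"
proof -
  have "(\<lambda>n. fps_nth (polylog_fps k) n * of_real z ^ n) sums eval_fps (polylog_fps k) (of_real z)"
    by (rule sums_eval_fps) (use assms in \<open>simp add: fps_conv_radius_polylog_fps\<close>)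
  from sums_Re[OF this]
  have "(\<lambda>n. Re (fps_nth (polylog_fps k) n * of_real z ^ n)) sums
          Re (eval_fps (polylog_fps k) (of_real z))" .
  moreover have "Re (fps_nth (polylog_fps k) n * of_real z ^ n) =
      1 / of_nat (Suc n) powi k * z ^ n" for n
  proof -
    have "fps_nth (polylog_fps k) n * of_real z ^ n =
        complex_of_real (1 / of_nat (Suc n) powi k * z ^ n)"
      by (simp add: polylog_fps_def)
    thus ?thesis by (simp only: Re_complex_of_real)
  qed
  ultimately have "(\<lambda>n. 1 / of_nat (Suc n) powi k * z ^ n) sums
      Re (eval_fps (polylog_fps k) (of_real z))"
    by simp
  \<comment> \<open>Multiplying by \<open>z\<close> undoes the index shift in
    \<open>polylog_fps\<close>.\<close>
  from sums_mult[OF this, of z] show ?thesis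
    unfolding polylog_def by (simp add: sums_iff mult_ac)
qed

lemma poly_bernoulli_gf_has_fps_expansion:
  assumes "b > 0" "b \<noteq> 1"
  obtains g :: "real \<Rightarrow> real" and P where
    "g has_fps_expansion P"
    "\<forall>\<^sub>F t in at 0. polylog k (1 - b powr (- t)) / (b powr t - 1) = g t"
proof -
  define L where "L = ln b"
  have "L \<noteq> 0"
    using assms by (simp add: L_def)
  have powr: "b powr t = exp (L * t)" for t
    using assms by (simp add: powr_def L_def mult.commute)
  \<comment> \<open>With \<open>z = 1 - exp (- L * t)\<close>, the denominator is
    \<open>exp (L * t) * z\<close>; cancelling \<open>z\<close> leaves this function, which is also
    defined at \<open>0\<close>.\<close>
  define h where
    "h = (\<lambda>s. exp (- of_real L * s) * (eval_fps (polylog_fps k) \<circ> (\<lambda>s. 1 - exp (- of_real L * s))) s)"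
  have h: "h has_fps_expansion
      fps_exp (- of_real L) * fps_compose (polylog_fps k) (1 - fps_exp (- of_real L))"
    unfolding h_def
    \<comment> \<open>The composition is legitimate because \<open>1 - fps_exp (- of_real L)\<close>
      has constant coefficient \<open>0\<close>.\<close>
    by (intro has_fps_expansion_mult has_fps_expansion_compose has_fps_expansion_exp
        has_fps_expansion_diff has_fps_expansion_1 eval_fps_has_fps_expansion)
       (simp_all add: fps_conv_radius_polylog_fps)
  \<comment> \<open>Close to \<open>0\<close> the argument of \<open>polylog\<close> lies in the
    unit disc, where its series represents it.\<close>
  have "((\<lambda>t. \<bar>1 - exp (- L * t)\<bar>) \<longlongrightarrow> \<bar>1 - exp (- L * 0)\<bar>) (at 0)"
    by (intro tendsto_intros)
  hence "\<forall>\<^sub>F t in at 0. \<bar>1 - exp (- L * t)\<bar> < 1"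
    by (rule order_tendstoD) simp
  moreover have "\<forall>\<^sub>F t in at (0::real). t \<noteq> 0"
    by (rule eventually_neq_at_within)
  ultimately have "\<forall>\<^sub>F t in at 0. polylog k (1 - b powr (- t)) / (b powr t - 1) =
      Re (h (of_real t))"
  proof eventually_elim
    case (elim t)
    define z where "z = 1 - exp (- L * t)"
    have "z \<noteq> 0"
      using \<open>L \<noteq> 0\<close> \<open>t \<noteq> 0\<close> by (simp add: z_def)
    have "exp (L * t) - 1 = exp (L * t) * z"
      by (simp add: z_def algebra_simps flip: exp_add)
    moreover have "b powr (- t) = 1 - z"
      by (simp add: powr z_def)
    ultimately have "polylog k (1 - b powr (- t)) / (b powr t - 1) =
        polylog k z / (exp (L * t) * z)"
      by (simp add: powr)
    also have "\<dots> = exp (- L * t) * Re (eval_fps (polylog_fps k) (of_real z))"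
      using \<open>z \<noteq> 0\<close> elim(1) by (simp add: polylog_eq_eval_fps z_def exp_minus field_simps)
    also have "\<dots> = Re (of_real (exp (- L * t)) * eval_fps (polylog_fps k) (of_real z))"
      by simp
    also have "of_real (exp (- L * t)) * eval_fps (polylog_fps k) (of_real z) = h (of_real t)"
      by (simp add: h_def z_def exp_of_real [symmetric])
    finally show ?case .
  qed
  with has_fps_expansion_Re[OF h] show thesis
    by (rule that)
qed

theorem theorem5:
  fixes k\<^sub>1 :: int and n :: nat and x y b :: real
  assumes "b > 0" and "b \<noteq> 1"
  shows "gen_poly_bernoulli k\<^sub>1 n (x + y) 1 b b =
    1 / 2 * (\<Sum>k=0..n. real (n choose k) *
      (gen_poly_bernoulli k\<^sub>1 k y 1 b b + gen_poly_bernoulli k\<^sub>1 k (y + 1) 1 b b) *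
      gen_euler (n - k) x 1 b b)"
proof -
  define L where "L = ln b"
  have powr: "b powr t = exp (L * t)" for t
    using assms by (simp add: powr_def L_def mult.commute)
  obtain g P where g: "g has_fps_expansion P"
    "\<forall>\<^sub>F t in at 0. polylog k\<^sub>1 (1 - b powr (- t)) / (b powr t - 1) = g t"
    using poly_bernoulli_gf_has_fps_expansion[OF assms] by blast
  \<comment> \<open>\<open>B u\<close> and \<open>E\<close> are the generating functions as formal
    series; their coefficients lack the factorials of the polynomials.\<close>
  define B where "B u = P * fps_exp (u * L)" for u
  define E where "E = fps_const 2 * fps_exp (x * L) / (fps_exp L + 1)"
  have B: "gen_poly_bernoulli k\<^sub>1 m u 1 b b = fact m * fps_nth (B u) m" for m u
    unfolding gen_poly_bernoulli_def B_def
  proof (rule egf_coeffs_eqI)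
    show "(\<lambda>t. g t * exp (u * L * t)) has_fps_expansion P * fps_exp (u * L)"
      by (intro has_fps_expansion_mult g has_fps_expansion_exp)
    show "\<forall>\<^sub>F t in at 0. polylog k\<^sub>1 (1 - (1 * b) powr (- t)) / (b powr t - 1 powr (- t)) *
        b powr (u * t) = g t * exp (u * L * t)"
      using g(2) by eventually_elim (simp add: powr mult_ac)
  qed
  have E: "gen_euler m x 1 b b = fact m * fps_nth E m" for m
    unfolding gen_euler_def E_def
  proof (rule egf_coeffs_eqI)
    show "(\<lambda>t. 2 * exp (x * L * t) / (exp (L * t) + 1)) has_fps_expansion
        fps_const 2 * fps_exp (x * L) / (fps_exp L + 1)"
      by (intro has_fps_expansion_divide' has_fps_expansion_cmult_left has_fps_expansion_add
          has_fps_expansion_exp has_fps_expansion_1) simp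
    show "\<forall>\<^sub>F t in at 0. 2 * b powr (x * t) / (b powr t + 1 powr t) =
        2 * exp (x * L * t) / (exp (L * t) + 1)"
      by (intro always_eventually) (simp add: powr mult_ac)
  qed
  \<comment> \<open>The constant coefficient is \<open>2\<close>, so the divisor is a unit and the
    division defining \<open>E\<close> is exact.\<close>
  have "fps_nth (fps_exp L + 1) 0 \<noteq> 0"
    by simp
  hence "E * (fps_exp L + 1) = fps_const 2 * fps_exp (x * L)"
    unfolding E_def by (metis dvd_div_mult_self fps_is_unit_iff unit_imp_dvd)
  \<comment> \<open>Shifting \<open>y\<close> by \<open>1\<close> multiplies the series by
    \<open>fps_exp L\<close>, which produces exactly the denominator of \<open>E\<close>.\<close>
  moreover have "B y + B (y + 1) = B y * (fps_exp L + 1)"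
    by (simp add: B_def algebra_simps fps_exp_add_mult)
  ultimately have "(B y + B (y + 1)) * E = B y * (fps_const 2 * fps_exp (x * L))"
    by (metis mult.assoc mult.commute)
  also have "\<dots> = fps_const 2 * B (x + y)"
    by (simp add: B_def algebra_simps fps_exp_add_mult)
  finally have prod: "(B y + B (y + 1)) * E = fps_const 2 * B (x + y)" .
  have "2 * (fact n * fps_nth (B (x + y)) n) = fact n * fps_nth ((B y + B (y + 1)) * E) n"
    by (simp add: prod)
  also have "\<dots> = (\<Sum>k=0..n. fact n * (fps_nth (B y + B (y + 1)) k * fps_nth E (n - k)))"
    by (simp add: fps_mult_nth sum_distrib_left)
  \<comment> \<open>For \<open>k \<le> n\<close>, \<open>fact n\<close> splits as
    \<open>(n choose k) * fact k * fact (n - k)\<close>, turning the Cauchy product into a binomial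
    convolution.\<close>
  also have "\<dots> = (\<Sum>k=0..n. real (n choose k) *
      (fact k * fps_nth (B y) k + fact k * fps_nth (B (y + 1)) k) *
      (fact (n - k) * fps_nth E (n - k)))"
    by (intro sum.cong refl) (simp add: binomial_fact field_simps)
  finally show ?thesis
    unfolding B E by simp
qed

end
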